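(* For every integer $n\ge 2$, there are, up to isomorphism, exactly $2^{n-2}$ commutative idempotent residuated chains with $n$ elements.
   Context: A residuated lattice is an algebra $\mathbf A=\langle A,\wedge,\vee,\cdot,\backslash,/,\mathrm e\rangle$ such that $\langle A,\wedge,\vee\rangle$ is a lattice, $\langle A,\cdot,\mathrm e\rangle$ is a monoid, and for all $a,b,c\in A$: $b\le a\backslash c\iff a\cdot b\le c\iff a\le c/b$. It is commutative if $ab=ba$ for all $a,b\in A$, idempotent if $aa=a$ for all $a\in A$, and a residuated chain if its lattice order is total. No relation between $\mathrm e$ and the greatest element of the lattice is assumed. *)

theory Defs
  imports "HOL-Algebra.Group"
begin

record 'a residuated_algebra = "'a monoid" +
  meet_op :: "'a \<Rightarrow> 'a \<Rightarrow> 'a" (infixl "\<curlywedge>\<index>" 70)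
  join_op :: "'a \<Rightarrow> 'a \<Rightarrow> 'a" (infixl "\<curlyvee>\<index>" 65)
  ldiv :: "'a \<Rightarrow> 'a \<Rightarrow> 'a"
  rdiv :: "'a \<Rightarrow> 'a \<Rightarrow> 'a"

text \<open>The lattice reduct is given algebraically; this is its induced order.\<close>

definition lat_le :: "('a, 'm) residuated_algebra_scheme \<Rightarrow> 'a \<Rightarrow> 'a \<Rightarrow> bool"
    (infix "\<preceq>\<index>" 50)
  where "x \<preceq>\<^bsub>A\<^esub> y \<longleftrightarrow> x \<curlywedge>\<^bsub>A\<^esub> y = x"

text \<open>\<open>ldiv A a c\<close> is $a \backslash c$ and \<open>rdiv A c b\<close> is $c / b$. The idempotent laws
  of a lattice follow from the absorption laws.\<close>

locale residuated_lattice = monoid A for A (structure) +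
  assumes meet_closed: "\<lbrakk>x \<in> carrier A; y \<in> carrier A\<rbrakk> \<Longrightarrow> x \<curlywedge> y \<in> carrier A"
    and join_closed: "\<lbrakk>x \<in> carrier A; y \<in> carrier A\<rbrakk> \<Longrightarrow> x \<curlyvee> y \<in> carrier A"
    and ldiv_closed: "\<lbrakk>x \<in> carrier A; y \<in> carrier A\<rbrakk> \<Longrightarrow> ldiv A x y \<in> carrier A"
    and rdiv_closed: "\<lbrakk>x \<in> carrier A; y \<in> carrier A\<rbrakk> \<Longrightarrow> rdiv A x y \<in> carrier A"
    and meet_commute: "\<lbrakk>x \<in> carrier A; y \<in> carrier A\<rbrakk> \<Longrightarrow> x \<curlywedge> y = y \<curlywedge> x"
    and join_commute: "\<lbrakk>x \<in> carrier A; y \<in> carrier A\<rbrakk> \<Longrightarrow> x \<curlyvee> y = y \<curlyvee> x"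
    and meet_associative:
      "\<lbrakk>x \<in> carrier A; y \<in> carrier A; z \<in> carrier A\<rbrakk> \<Longrightarrow> (x \<curlywedge> y) \<curlywedge> z = x \<curlywedge> (y \<curlywedge> z)"
    and join_associative:
      "\<lbrakk>x \<in> carrier A; y \<in> carrier A; z \<in> carrier A\<rbrakk> \<Longrightarrow> (x \<curlyvee> y) \<curlyvee> z = x \<curlyvee> (y \<curlyvee> z)"
    and meet_absorb: "\<lbrakk>x \<in> carrier A; y \<in> carrier A\<rbrakk> \<Longrightarrow> x \<curlywedge> (x \<curlyvee> y) = x"
    and join_absorb: "\<lbrakk>x \<in> carrier A; y \<in> carrier A\<rbrakk> \<Longrightarrow> x \<curlyvee> (x \<curlywedge> y) = x"
    and ldiv_residual:
      "\<lbrakk>a \<in> carrier A; b \<in> carrier A; c \<in> carrier A\<rbrakk> \<Longrightarrow> b \<preceq> ldiv A a c \<longleftrightarrow> a \<otimes> b \<preceq> c"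
    and rdiv_residual:
      "\<lbrakk>a \<in> carrier A; b \<in> carrier A; c \<in> carrier A\<rbrakk> \<Longrightarrow> a \<otimes> b \<preceq> c \<longleftrightarrow> a \<preceq> rdiv A c b"

locale comm_idem_residuated_chain = residuated_lattice A + comm_monoid A for A (structure) +
  assumes mult_idem: "x \<in> carrier A \<Longrightarrow> x \<otimes> x = x"
    and total: "\<lbrakk>x \<in> carrier A; y \<in> carrier A\<rbrakk> \<Longrightarrow> x \<preceq> y \<or> y \<preceq> x"

definition rl_iso ::
    "('a, 'm) residuated_algebra_scheme \<Rightarrow> ('b, 'n) residuated_algebra_scheme \<Rightarrow> ('a \<Rightarrow> 'b) set"
  where "rl_iso A B =
    {h \<in> iso A B. h \<one>\<^bsub>A\<^esub> = \<one>\<^bsub>B\<^esub> \<and>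
      (\<forall>x \<in> carrier A. \<forall>y \<in> carrier A.
        h (x \<curlywedge>\<^bsub>A\<^esub> y) = h x \<curlywedge>\<^bsub>B\<^esub> h y \<and>
        h (x \<curlyvee>\<^bsub>A\<^esub> y) = h x \<curlyvee>\<^bsub>B\<^esub> h y \<and>
        h (ldiv A x y) = ldiv B (h x) (h y) \<and>
        h (rdiv A x y) = rdiv B (h x) (h y))}"

definition rl_isomorphic ::
    "('a, 'm) residuated_algebra_scheme \<Rightarrow> ('b, 'n) residuated_algebra_scheme \<Rightarrow> bool"
  where "rl_isomorphic A B \<longleftrightarrow> rl_iso A B \<noteq> {}"

end

theory Submission
  imports Defs
begin

text \<open>Multiplication in a commutative idempotent residuated chain is conservative, so it is
  the minimum operation of a second total order, the monoidal order. Its greatest element is the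
  unit and its least element is the lattice bottom; it agrees with the lattice order below the unit
  and is opposite to it above the unit. Listing the elements along the monoidal order, the algebra
  is therefore determined by the set of positions strictly between the first and the last that
  hold an element above the unit, and every subset of these \<open>n - 2\<close> positions occurs.\<close>

section \<open>Products in a commutative idempotent residuated chain\<close>

context comm_idem_residuated_chain
begin

lemma le_refl: "x \<in> carrier A \<Longrightarrow> x \<preceq> x"
  using total by blast

lemma le_antisym: "\<lbrakk>x \<preceq> y; y \<preceq> x; x \<in> carrier A; y \<in> carrier A\<rbrakk> \<Longrightarrow> x = y"
  unfolding lat_le_def using meet_commute by metis

lemma le_trans:
  "\<lbrakk>x \<preceq> y; y \<preceq> z; x \<in> carrier A; y \<in> carrier A; z \<in> carrier A\<rbrakk> \<Longrightarrow> x \<preceq> z"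
  unfolding lat_le_def using meet_associative by metis

lemma join_eq_right: "\<lbrakk>x \<preceq> y; x \<in> carrier A; y \<in> carrier A\<rbrakk> \<Longrightarrow> x \<curlyvee> y = y"
  unfolding lat_le_def using join_absorb join_commute meet_commute by metis

text \<open>Multiplication by \<open>z\<close> has the residual \<open>ldiv A z\<close> as upper
  adjoint, hence preserves the order.\<close>

lemma mult_mono:
  assumes "x \<preceq> y" "x \<in> carrier A" "y \<in> carrier A" "z \<in> carrier A"
  shows "z \<otimes> x \<preceq> z \<otimes> y"
proof -
  have "y \<preceq> ldiv A z (z \<otimes> y)"
    using assms ldiv_residual le_refl by simp
  then have "x \<preceq> ldiv A z (z \<otimes> y)"
    using assms le_trans ldiv_closed by (meson m_closed)
  then show ?thesis
    using assms ldiv_residual by simp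
qed

text \<open>Monotonicity squeezes the product between the square of \<open>x\<close>, which is
  \<open>x\<close>, and the product of \<open>x\<close> with the unit.\<close>

lemma mult_negative:
  assumes "x \<preceq> y" "y \<preceq> \<one>" "x \<in> carrier A" "y \<in> carrier A"
  shows "x \<otimes> y = x"
proof (rule le_antisym)
  show "x \<otimes> y \<preceq> x"
    using mult_mono[of y \<one> x] assms by simp
  show "x \<preceq> x \<otimes> y"
    using mult_mono[of x y x] assms mult_idem by simp
qed (use assms in auto)

lemma mult_positive:
  assumes "x \<preceq> y" "\<one> \<preceq> x" "x \<in> carrier A" "y \<in> carrier A"
  shows "x \<otimes> y = y"
proof (rule le_antisym)
  show "y \<preceq> x \<otimes> y"
    using mult_mono[of \<one> x y] assms by (simp add: m_comm)
  show "x \<otimes> y \<preceq> y"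
    using mult_mono[of x y y] assms mult_idem by (simp add: m_comm)
qed (use assms in auto)

lemma mult_mixed:
  assumes "x \<preceq> \<one>" "\<one> \<preceq> y" "x \<in> carrier A" "y \<in> carrier A"
  shows "x \<otimes> y = x \<or> x \<otimes> y = y"
proof -
  have cl: "x \<otimes> y \<in> carrier A"
    using assms by simp
  \<comment> \<open>By idempotence the product absorbs each of its factors.\<close>
  have x: "x \<otimes> (x \<otimes> y) = x \<otimes> y" and y: "y \<otimes> (x \<otimes> y) = x \<otimes> y"
    using assms mult_idem by (simp_all add: m_assoc[symmetric]) (simp add: m_ac mult_idem)
  have lower: "x \<preceq> x \<otimes> y" and upper: "x \<otimes> y \<preceq> y"
    using mult_mono[of \<one> y x] mult_mono[of x \<one> y] assms by (simp_all add: m_comm)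
  show ?thesis
  \<comment> \<open>Compare the product with the unit. If it is below, multiplying this inequality
    by \<open>x\<close> puts the product below \<open>x\<close>; if it is above, multiplying by
    \<open>y\<close> puts it above \<open>y\<close>.\<close>
  proof (cases "x \<otimes> y \<preceq> \<one>")
    case True
    then have "x \<otimes> y \<preceq> x"
      using mult_mono[of "x \<otimes> y" \<one> x] assms cl x by simp
    then show ?thesis
      using lower le_antisym assms cl by blast
  next
    case False
    then have "\<one> \<preceq> x \<otimes> y"
      using total cl by blast
    then have "y \<preceq> x \<otimes> y"
      using mult_mono[of \<one> "x \<otimes> y" y] assms cl y by simp
    then show ?thesis
      using upper le_antisym assms cl by blast
  qed
qed

lemma mult_conservative:
  assumes "x \<in> carrier A" "y \<in> carrier A"
  shows "x \<otimes> y = x \<or> x \<otimes> y = y"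
  using assms total[of x y] total[of x \<one>] total[of y \<one>] mult_negative[of x y] mult_negative[of y x]
    mult_positive[of x y] mult_positive[of y x] mult_mixed[of x y] mult_mixed[of y x]
  by (metis m_comm one_closed)

text \<open>The bottom lies below \<open>ldiv A x b\<close>, and residuation turns this into a bound
  on the product.\<close>

lemma bottom_absorbing:
  assumes "b \<in> carrier A" "x \<in> carrier A" "\<And>y. y \<in> carrier A \<Longrightarrow> b \<preceq> y"
  shows "b \<otimes> x = b"
proof (rule le_antisym)
  have "b \<preceq> ldiv A x b"
    using assms ldiv_closed by blast
  then show "b \<otimes> x \<preceq> b"
    using assms ldiv_residual by (simp add: m_comm)
qed (use assms in auto)

lemma exists_bottom:
  assumes "finite (carrier A)"
  obtains b where "b \<in> carrier A" "\<And>y. y \<in> carrier A \<Longrightarrow> b \<preceq> y"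
proof -
  have "\<exists>b\<in>F. \<forall>y\<in>F. b \<preceq> y" if "finite F" "F \<noteq> {}" "F \<subseteq> carrier A" for F
    using that
  proof (induction rule: finite_ne_induct)
    case (singleton x)
    then show ?case
      using le_refl by simp
  next
    case (insert x F)
    then obtain b where b: "b \<in> F" "\<forall>y\<in>F. b \<preceq> y"
      by blast
    have x: "x \<in> carrier A" and F: "F \<subseteq> carrier A"
      using insert.prems by simp_all
    show ?case
    proof (cases "b \<preceq> x")
      case True
      then show ?thesis
        using b by blast
    next
      case False
      then have "x \<preceq> b"
        using total b F x by blast
      then have "\<forall>y\<in>F. x \<preceq> y"
        using b F x le_trans by blast
      then show ?thesis
        using le_refl x by blast
    qed
  qed
  from this[of "carrier A"] show thesis
    using that assms one_closed by blast
qed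

section \<open>Ranks along the monoidal order\<close>

text \<open>The set is the principal down-set of \<open>x\<close> in the monoidal order. It contains
  \<open>x\<close>, so subtracting 1 makes the ranks start at 0.\<close>

definition mrank :: "'a \<Rightarrow> nat"
  where "mrank x = card {y \<in> carrier A. y \<otimes> x = y} - 1"

lemma Suc_mrank:
  assumes "finite (carrier A)" "x \<in> carrier A"
  shows "Suc (mrank x) = card {y \<in> carrier A. y \<otimes> x = y}"
proof -
  have "{y \<in> carrier A. y \<otimes> x = y} \<noteq> {}"
    using assms mult_idem by auto
  then have "card {y \<in> carrier A. y \<otimes> x = y} > 0"
    using assms by (simp add: card_gt_0_iff)
  then show ?thesis
    unfolding mrank_def by simp
qed

lemma mrank_le_iff:
  assumes fin: "finite (carrier A)" and x: "x \<in> carrier A" and y: "y \<in> carrier A"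
  shows "mrank x \<le> mrank y \<longleftrightarrow> x \<otimes> y = x"
proof -
  let ?L = "\<lambda>x. {z \<in> carrier A. z \<otimes> x = z}"
  have sub: "?L u \<subseteq> ?L v" if "u \<otimes> v = u" "u \<in> carrier A" "v \<in> carrier A" for u v
  proof
    fix z assume "z \<in> ?L u"
    then show "z \<in> ?L v"
      using that m_assoc[of z u v] by simp
  qed
  have "mrank x \<le> mrank y \<longleftrightarrow> card (?L x) \<le> card (?L y)"
    by (simp add: fin x y flip: Suc_mrank)
  also have "\<dots> \<longleftrightarrow> x \<otimes> y = x"
  proof
    assume card: "card (?L x) \<le> card (?L y)"
    show "x \<otimes> y = x"
    proof (rule ccontr)
      assume "x \<otimes> y \<noteq> x"
      then have "y \<otimes> x = y"
        using mult_conservative[OF x y] x y by (simp add: m_comm)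
      \<comment> \<open>The down-set of \<open>y\<close> lies in that of \<open>x\<close> and is at
        least as large, so they coincide; but \<open>x\<close> belongs only to its own.\<close>
      then have "?L y = ?L x"
        using sub[of y x] card card_seteq[of "?L x" "?L y"] fin x y by simp
      then show False
        using x mult_idem[OF x] \<open>x \<otimes> y \<noteq> x\<close> by blast
    qed
  next
    assume "x \<otimes> y = x"
    then show "card (?L x) \<le> card (?L y)"
      using sub x y fin by (intro card_mono) auto
  qed
  finally show ?thesis .
qed

lemma mrank_inj:
  assumes "finite (carrier A)"
  shows "inj_on mrank (carrier A)"
  using assms mrank_le_iff by (intro inj_onI) (metis le_refl m_comm order_refl)

lemma mrank_bij:
  assumes "finite (carrier A)"
  shows "bij_betw mrank (carrier A) {0..<card (carrier A)}"
proof -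
  have "Suc (mrank x) \<le> card (carrier A)" if "x \<in> carrier A" for x
    unfolding Suc_mrank[OF assms that] using assms by (intro card_mono) auto
  then have "mrank ` carrier A \<subseteq> {0..<card (carrier A)}"
    by (auto simp: Suc_le_eq)
  then have "mrank ` carrier A = {0..<card (carrier A)}"
    using card_image[OF mrank_inj[OF assms]] by (intro card_subset_eq) auto
  then show ?thesis
    using mrank_inj[OF assms] by (simp add: bij_betw_def)
qed

lemma mrank_mult:
  assumes "finite (carrier A)" "x \<in> carrier A" "y \<in> carrier A"
  shows "mrank (x \<otimes> y) = min (mrank x) (mrank y)"
  using assms mrank_le_iff[of x y] mrank_le_iff[of y x] mult_conservative[of x y]
  by (auto simp: min_def m_comm)

lemma mrank_one:
  assumes "finite (carrier A)"
  shows "mrank \<one> = card (carrier A) - 1"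
proof -
  have "{y \<in> carrier A. y \<otimes> \<one> = y} = carrier A"
    by auto
  then show ?thesis
    by (simp add: mrank_def)
qed

end

section \<open>A criterion for isomorphism\<close>

text \<open>In a chain the order determines meet and join, and order and product together determine
  both residuals.\<close>

lemma rl_isoI:
  assumes A: "comm_idem_residuated_chain A" and B: "comm_idem_residuated_chain B"
    and bij: "bij_betw h (carrier A) (carrier B)"
    and mult: "\<And>x y. \<lbrakk>x \<in> carrier A; y \<in> carrier A\<rbrakk> \<Longrightarrow> h (x \<otimes>\<^bsub>A\<^esub> y) = h x \<otimes>\<^bsub>B\<^esub> h y"
    and le: "\<And>x y. \<lbrakk>x \<in> carrier A; y \<in> carrier A\<rbrakk> \<Longrightarrow> h x \<preceq>\<^bsub>B\<^esub> h y \<longleftrightarrow> x \<preceq>\<^bsub>A\<^esub> y"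
    and one: "h \<one>\<^bsub>A\<^esub> = \<one>\<^bsub>B\<^esub>"
  shows "h \<in> rl_iso A B"
proof -
  interpret A: comm_idem_residuated_chain A by fact
  interpret B: comm_idem_residuated_chain B by fact
  have h: "h x \<in> carrier B" if "x \<in> carrier A" for x
    using bij that by (auto simp: bij_betw_def)
  have surj: "\<exists>x\<in>carrier A. z = h x" if "z \<in> carrier B" for z
    using bij that by (auto simp: bij_betw_def)
  \<comment> \<open>An element is determined by the elements below it, and since \<open>h\<close> is
    onto, testing images suffices.\<close>
  have eqI: "u = v" if "u \<in> carrier B" "v \<in> carrier B"
    and "\<And>x. x \<in> carrier A \<Longrightarrow> h x \<preceq>\<^bsub>B\<^esub> u \<longleftrightarrow> h x \<preceq>\<^bsub>B\<^esub> v" for u v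
    using that surj B.le_refl B.le_antisym by metis
  have meet: "h (x \<curlywedge>\<^bsub>A\<^esub> y) = h x \<curlywedge>\<^bsub>B\<^esub> h y" if "x \<in> carrier A" "y \<in> carrier A" for x y
    using A.total[OF that] le[of x y] le[of y x] that h A.meet_commute B.meet_commute
    unfolding lat_le_def by metis
  have join: "h (x \<curlyvee>\<^bsub>A\<^esub> y) = h x \<curlyvee>\<^bsub>B\<^esub> h y" if "x \<in> carrier A" "y \<in> carrier A" for x y
    using A.total[OF that] le[of x y] le[of y x] that h A.join_commute B.join_commute
      A.join_eq_right B.join_eq_right by metis
  have ldiv: "h (ldiv A x y) = ldiv B (h x) (h y)" if "x \<in> carrier A" "y \<in> carrier A" for x y
  proof (rule eqI)
    fix z assume "z \<in> carrier A"
    then show "h z \<preceq>\<^bsub>B\<^esub> h (ldiv A x y) \<longleftrightarrow> h z \<preceq>\<^bsub>B\<^esub> ldiv B (h x) (h y)"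
      using that h by (simp add: le A.ldiv_closed A.ldiv_residual B.ldiv_residual flip: mult)
  qed (use that h A.ldiv_closed B.ldiv_closed in auto)
  have rdiv: "h (rdiv A x y) = rdiv B (h x) (h y)" if "x \<in> carrier A" "y \<in> carrier A" for x y
  proof (rule eqI)
    fix z assume "z \<in> carrier A"
    then show "h z \<preceq>\<^bsub>B\<^esub> h (rdiv A x y) \<longleftrightarrow> h z \<preceq>\<^bsub>B\<^esub> rdiv B (h x) (h y)"
      using that h A.rdiv_residual[of z y x] B.rdiv_residual[of "h z" "h y" "h x"]
      by (simp add: le A.rdiv_closed flip: mult)
  qed (use that h A.rdiv_closed B.rdiv_closed in auto)
  show ?thesis
    unfolding rl_iso_def using bij mult h one meet join ldiv rdiv
    by (auto simp: iso_def hom_def)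
qed

section \<open>The standard models\<close>

text \<open>The elements of the standard model are listed along the monoidal order and \<open>S\<close> is the set
  of elements above the unit; \<open>chain_key\<close> realises the lattice order.\<close>

definition chain_key :: "nat \<Rightarrow> nat set \<Rightarrow> nat \<Rightarrow> nat"
  where "chain_key n S x = (if x \<in> S then 2 * n - x else x)"

text \<open>In a finite chain a residual is the largest solution of its inequality; as
  \<open>min\<close> is commutative, one function serves both divisions. The choice by
  \<open>arg_max\<close> is meaningful once a solution exists.\<close>

definition chain_residual :: "nat \<Rightarrow> nat set \<Rightarrow> nat \<Rightarrow> nat \<Rightarrow> nat"
  where "chain_residual n S a c =
    arg_max (chain_key n S) (\<lambda>b. b < n \<and> chain_key n S (min a b) \<le> chain_key n S c)"

definition chain_model :: "nat \<Rightarrow> nat set \<Rightarrow> nat residuated_algebra"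
  where "chain_model n S =
    \<lparr>carrier = {0..<n}, mult = min, one = n - 1,
     meet_op = (\<lambda>x y. if chain_key n S x \<le> chain_key n S y then x else y),
     join_op = (\<lambda>x y. if chain_key n S x \<le> chain_key n S y then y else x),
     ldiv = chain_residual n S,
     rdiv = (\<lambda>c b. chain_residual n S b c)\<rparr>"

lemma chain_model_simps [simp]:
  "carrier (chain_model n S) = {0..<n}"
  "x \<otimes>\<^bsub>chain_model n S\<^esub> y = min x y"
  "\<one>\<^bsub>chain_model n S\<^esub> = n - 1"
  "x \<curlywedge>\<^bsub>chain_model n S\<^esub> y = (if chain_key n S x \<le> chain_key n S y then x else y)"
  "x \<curlyvee>\<^bsub>chain_model n S\<^esub> y = (if chain_key n S x \<le> chain_key n S y then y else x)"
  "ldiv (chain_model n S) a c = chain_residual n S a c"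
  "rdiv (chain_model n S) c a = chain_residual n S a c"
  by (simp_all add: chain_model_def)

text \<open>Keys of elements of \<open>S\<close> exceed \<open>n\<close> and all other keys are
  below \<open>n\<close>, so the two cases cannot collide.\<close>

lemma chain_key_inject:
  "\<lbrakk>x < n; y < n\<rbrakk> \<Longrightarrow> chain_key n S x = chain_key n S y \<longleftrightarrow> x = y"
  by (auto simp: chain_key_def split: if_splits)

lemma chain_model_le:
  "\<lbrakk>x < n; y < n\<rbrakk> \<Longrightarrow> x \<preceq>\<^bsub>chain_model n S\<^esub> y \<longleftrightarrow> chain_key n S x \<le> chain_key n S y"
  by (auto simp: lat_le_def)

text \<open>Only the case where \<open>z\<close> replaces exactly one argument needs thought. If x <
  z \<le> y, then \<open>x\<close> is outside \<open>S\<close>, and its key is below that of every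
  larger position; if y < z \<le> x, then \<open>y\<close> is in \<open>S\<close>, and its key is
  above that of every larger position.\<close>

lemma chain_key_min_mono:
  "\<lbrakk>chain_key n S x \<le> chain_key n S y; x < n; y < n; z < n\<rbrakk>
    \<Longrightarrow> chain_key n S (min z x) \<le> chain_key n S (min z y)"
  by (auto simp: chain_key_def min_def split: if_splits)

lemma chain_residual:
  assumes "0 \<notin> S" "a < n" "c < n"
  shows "chain_residual n S a c < n"
    and "b < n \<Longrightarrow> chain_key n S b \<le> chain_key n S (chain_residual n S a c)
      \<longleftrightarrow> chain_key n S (min a b) \<le> chain_key n S c"
proof -
  let ?P = "\<lambda>b. b < n \<and> chain_key n S (min a b) \<le> chain_key n S c"
  \<comment> \<open>Position 0 absorbs every product and, being outside \<open>S\<close>, has the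
    least key, so a solution always exists.\<close>
  have "?P 0"
    using assms by (simp add: chain_key_def)
  moreover have "\<forall>y. ?P y \<longrightarrow> chain_key n S y < 2 * n + 1"
    by (auto simp: chain_key_def)
  ultimately have max: "?P (chain_residual n S a c)"
    "\<forall>y. ?P y \<longrightarrow> chain_key n S y \<le> chain_key n S (chain_residual n S a c)"
    unfolding chain_residual_def
    by (rule arg_max_nat_lemma[THEN conjunct1], rule arg_max_nat_lemma[THEN conjunct2])
  then show "chain_residual n S a c < n"
    by blast
  \<comment> \<open>One direction is maximality; for the other, monotonicity makes everything below
    a solution a solution.\<close>
  show "chain_key n S b \<le> chain_key n S (chain_residual n S a c)
      \<longleftrightarrow> chain_key n S (min a b) \<le> chain_key n S c" if "b < n"
    using max that assms chain_key_min_mono[of n S b "chain_residual n S a c" a]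
    by (meson order_trans)
qed

lemma chain_model_chain:
  assumes "n > 0" "0 \<notin> S"
  shows "comm_idem_residuated_chain (chain_model n S)"
  by unfold_locales
    (use assms in \<open>auto simp: chain_model_le chain_residual chain_key_inject min.commute min.assoc\<close>)

section \<open>Rigidity of the standard models\<close>

lemma strict_mono_on_atLeastLessThan_id:
  fixes f :: "nat \<Rightarrow> nat"
  assumes mono: "strict_mono_on {0..<n} f" and im: "f ` {0..<n} \<subseteq> {0..<n}" and x: "x < n"
  shows "f x = x"
proof -
  have lower: "x \<le> f x" if "x < n" for x
    using that
  proof (induction x)
    case (Suc x)
    then have "f x < f (Suc x)"
      using mono by (auto simp: strict_mono_on_def)
    then show ?case
      using Suc by simp
  qed simp
  \<comment> \<open>Downward induction from \<open>n - 1\<close>, with \<open>k\<close> the distance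
    from the top.\<close>
  have upper: "f (n - Suc k) \<le> n - Suc k" if "k < n" for k
    using that
  proof (induction k)
    case 0
    then have "f (n - 1) < n"
      using im by (simp add: image_subset_iff)
    then show ?case
      by simp
  next
    case (Suc k)
    then have "f (n - Suc (Suc k)) < f (n - Suc k)"
      using mono by (auto simp: strict_mono_on_def)
    then show ?case
      using Suc by simp
  qed
  show ?thesis
    using lower[OF x] upper[of "n - Suc x"] x by simp
qed

text \<open>An isomorphism preserves \<open>min\<close>, so it is strictly increasing and thus the
  identity. The two models then share their meets with the unit, and these reveal the set.\<close>

lemma chain_model_rigid:
  assumes S: "S \<subseteq> {1..<n - 1}" and T: "T \<subseteq> {1..<n - 1}"
    and iso: "rl_isomorphic (chain_model n S) (chain_model n T)"
  shows "S = T"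
proof -
  obtain h where h: "h \<in> rl_iso (chain_model n S) (chain_model n T)"
    using iso by (auto simp: rl_isomorphic_def)
  then have bij: "bij_betw h {0..<n} {0..<n}"
    and mult: "\<And>x y. \<lbrakk>x < n; y < n\<rbrakk> \<Longrightarrow> h (min x y) = min (h x) (h y)"
    and meet: "\<And>x y. \<lbrakk>x < n; y < n\<rbrakk> \<Longrightarrow>
      h (x \<curlywedge>\<^bsub>chain_model n S\<^esub> y) = h x \<curlywedge>\<^bsub>chain_model n T\<^esub> h y"
    by (auto simp: rl_iso_def iso_def hom_def)
  have "strict_mono_on {0..<n} h"
  proof (rule strict_mono_onI)
    fix x y assume xy: "x \<in> {0..<n}" "y \<in> {0..<n}" "x < y"
    then have "h x \<noteq> h y"
      using bij inj_on_contraD[of h "{0..<n}" x y] by (simp add: bij_betw_def)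
    moreover have "h x = min (h x) (h y)"
      using mult[of x y] xy by (simp add: min_def)
    ultimately show "h x < h y"
      by (simp add: min_def split: if_splits)
  qed
  then have id: "h x = x" if "x < n" for x
    using that bij by (intro strict_mono_on_atLeastLessThan_id[of n]) (auto simp: bij_betw_def)
  \<comment> \<open>The unit \<open>n - 1\<close> is outside \<open>U\<close>, so its key is
    \<open>n - 1\<close>. Members of \<open>U\<close> have larger keys and meet it in
    \<open>n - 1\<close>; the others have keys at most \<open>n - 1\<close> and stay fixed.\<close>
  have pos: "x \<in> U \<longleftrightarrow> x \<curlywedge>\<^bsub>chain_model n U\<^esub> (n - 1) \<noteq> x"
    if "U \<subseteq> {1..<n - 1}" "x < n" for x U
    using that by (auto simp: chain_key_def)
  have "x \<in> S \<longleftrightarrow> x \<in> T" if "x < n" for x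
  proof -
    have "x \<curlywedge>\<^bsub>chain_model n S\<^esub> (n - 1) = x \<curlywedge>\<^bsub>chain_model n T\<^esub> (n - 1)"
      using meet[of x "n - 1"] that id[of x] id[of "n - 1"]
        id[of "x \<curlywedge>\<^bsub>chain_model n S\<^esub> (n - 1)"] by auto
    then show ?thesis
      using pos[OF S that] pos[OF T that] by simp
  qed
  moreover have "S \<subseteq> {0..<n}" "T \<subseteq> {0..<n}"
    using S T by force+
  ultimately show ?thesis
    by (meson atLeastLessThan_iff subsetD subsetI subset_antisym)
qed

section \<open>Reduction of finite chains to standard models\<close>

lemma (in comm_idem_residuated_chain) isomorphic_chain_model:
  assumes card: "card (carrier A) = n" and n: "n > 0"
  shows "\<exists>S \<subseteq> {1..<n - 1}. rl_isomorphic A (chain_model n S)"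
proof -
  have fin: "finite (carrier A)"
    \<comment> \<open>An infinite carrier would have cardinality 0.\<close>
    using card n by (intro card_ge_0_finite) simp
  \<comment> \<open>By totality these are the elements strictly above the unit; \<open>mrank\<close>
    will be the isomorphism.\<close>
  define P where "P = {x \<in> carrier A. \<not> x \<preceq> \<one>}"
  define S where "S = mrank ` P"
  have bij: "bij_betw mrank (carrier A) {0..<n}"
    using mrank_bij[OF fin] card by simp
  have S_iff: "mrank x \<in> S \<longleftrightarrow> \<not> x \<preceq> \<one>" if "x \<in> carrier A" for x
    using that mrank_inj[OF fin] unfolding S_def P_def by (auto dest: inj_onD)
  have less: "mrank x < n" if "x \<in> carrier A" for x
    using bij that by (auto simp: bij_betw_def)
  \<comment> \<open>The bottom has the least rank and the unit the greatest, and neither lies in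
    \<open>P\<close>.\<close>
  have "mrank x > 0 \<and> mrank x < n - 1" if "x \<in> P" for x
  proof -
    have x: "x \<in> carrier A" "\<not> x \<preceq> \<one>"
      using that by (auto simp: P_def)
    obtain b where b: "b \<in> carrier A" "\<And>y. y \<in> carrier A \<Longrightarrow> b \<preceq> y"
      using exists_bottom[OF fin] by blast
    have "x \<noteq> b" "x \<noteq> \<one>"
      using x b le_refl by auto
    then have "mrank x \<noteq> mrank b" "mrank x \<noteq> mrank \<one>"
      using x b mrank_inj[OF fin] by (auto dest: inj_onD)
    moreover have "mrank b \<le> mrank x"
      using mrank_le_iff[OF fin] bottom_absorbing x b by blast
    ultimately show ?thesis
      using less[OF x(1)] mrank_one[OF fin] card by simp
  qed
  then have S: "S \<subseteq> {1..<n - 1}"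
    by (force simp: S_def)
  \<comment> \<open>Ranks follow the lattice order below the unit and reverse it above, where
    \<open>chain_key\<close> reverses it back. In the mixed case the value \<open>n\<close>
    separates the two keys.\<close>
  have order: "chain_key n S (mrank x) \<le> chain_key n S (mrank y)"
    if xy: "x \<preceq> y" and x: "x \<in> carrier A" and y: "y \<in> carrier A" for x y
  proof (cases "x \<preceq> \<one>")
    case neg: True
    show ?thesis
    proof (cases "y \<preceq> \<one>")
      case True
      then have "mrank x \<le> mrank y"
        using mult_negative mrank_le_iff fin x y xy by blast
      then show ?thesis
        using neg True S_iff x y by (simp add: chain_key_def)
    next
      case False
      then show ?thesis
        using neg S_iff x y less[OF x] less[OF y] by (simp add: chain_key_def)
    qed
  next
    case False
    then have "\<one> \<preceq> x" "\<not> y \<preceq> \<one>"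
      using total le_trans xy x y by blast+
    then have "mrank y \<le> mrank x"
      using mult_positive[OF xy] mrank_le_iff[OF fin y x] x y by (simp add: m_comm)
    then show ?thesis
      using False \<open>\<not> y \<preceq> \<one>\<close> S_iff x y by (simp add: chain_key_def)
  qed
  \<comment> \<open>Totality and injectivity of keys and ranks turn the implication
    \<open>order\<close> into an equivalence.\<close>
  have le: "mrank x \<preceq>\<^bsub>chain_model n S\<^esub> mrank y \<longleftrightarrow> x \<preceq> y"
    if "x \<in> carrier A" "y \<in> carrier A" for x y
    using that order[of x y] order[of y x] total[of x y] less chain_key_inject[of "mrank x" n "mrank y" S]
      mrank_inj[OF fin, THEN inj_onD, of x y] le_refl
    by (auto simp: chain_model_le)
  have "mrank \<in> rl_iso A (chain_model n S)"
  proof (rule rl_isoI)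
    show "comm_idem_residuated_chain A"
      by unfold_locales
    show "comm_idem_residuated_chain (chain_model n S)"
      using S n by (intro chain_model_chain) auto
  qed (use bij mrank_mult[OF fin] mrank_one[OF fin] card le in simp_all)
  then show ?thesis
    using S by (auto simp: rl_isomorphic_def)
qed

text \<open>Counting up to isomorphism is expressed by a set of representatives over
  \<open>nat\<close>, because the algebras \<open>A\<close> may live on any type.\<close>

theorem theorem3p2:
  fixes n :: nat
  assumes "n \<ge> 2"
  shows "\<exists>R :: nat residuated_algebra set.
    card R = 2 ^ (n - 2) \<and>
    (\<forall>B \<in> R. comm_idem_residuated_chain B \<and> card (carrier B) = n) \<and>
    (\<forall>B \<in> R. \<forall>C \<in> R. rl_isomorphic B C \<longrightarrow> B = C) \<and>
    (\<forall>A :: 'a residuated_algebra.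
      comm_idem_residuated_chain A \<and> card (carrier A) = n \<longrightarrow>
      (\<exists>B \<in> R. rl_isomorphic A B))"
proof (intro exI conjI)
  let ?R = "chain_model n ` Pow {1..<n - 1}"
  have chain: "comm_idem_residuated_chain (chain_model n S)" if "S \<in> Pow {1..<n - 1}" for S
    using that assms by (intro chain_model_chain) auto
  have inj: "inj_on (chain_model n) (Pow {1..<n - 1})"
  proof (rule inj_onI)
    fix S T assume ST: "S \<in> Pow {1..<n - 1}" "T \<in> Pow {1..<n - 1}"
      and eq: "chain_model n S = chain_model n T"
    \<comment> \<open>Equal models are isomorphic by the identity, so rigidity yields equal
      sets.\<close>
    have "id \<in> rl_iso (chain_model n S) (chain_model n S)"
      using chain ST by (intro rl_isoI) auto
    then show "S = T"
      using chain_model_rigid[of S n T] ST eq by (auto simp: rl_isomorphic_def)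
  qed
  have "card {1..<n - 1} = n - 2"
    by simp
  then show "card ?R = 2 ^ (n - 2)"
    using card_image[OF inj] by (simp add: card_Pow)
  show "\<forall>B \<in> ?R. comm_idem_residuated_chain B \<and> card (carrier B) = n"
    using chain by auto
  show "\<forall>B \<in> ?R. \<forall>C \<in> ?R. rl_isomorphic B C \<longrightarrow> B = C"
    using chain_model_rigid by blast
  show "\<forall>A :: 'a residuated_algebra. comm_idem_residuated_chain A \<and> card (carrier A) = n \<longrightarrow>
      (\<exists>B \<in> ?R. rl_isomorphic A B)"
    using comm_idem_residuated_chain.isomorphic_chain_model assms by fastforce
qed

end
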